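(* For a graph $G$, $\operatorname{th}_{\lfloor \operatorname{Z}\rfloor}(G)=2$ if and only if $G$ is (isomorphic to) $K_2$ or $2K_1$.
   Context: All graphs are finite, simple, undirected. $K_n$ is the complete graph on $n$ vertices; $2K_1$ is the graph with two vertices and no edges. $\lfloor \operatorname{Z}\rfloor$ forcing: each vertex of $G$ is blue or white. A vertex is active if it is blue and has not yet performed a force. The $\lfloor \operatorname{Z}\rfloor$ color change rule: (i) a blue vertex $u$ can force a white vertex $w$ to become blue if $w$ is the only white neighbor of $u$; or (ii) if $v$ is active and all neighbors of $v$ are blue, then $v$ can force any single white vertex $w$ of $G$ to become blue (a "hop"). Write $u\to w$ when $u$ forces $w$. For $B\subseteq V(G)$, color $B$ blue and $V(G)\setminus B$ white, and apply the rule repeatedly, one force at a time, until no longer possible; the unordered set $\mathcal F$ of forces performed is called a set of $\lfloor \operatorname{Z}\rfloor$ forces of $B$ (it depends on choices). Put $\mathcal F^{(0)}=B$, and for $t\ge 0$ let $\mathcal F^{(t+1)}$ be the set of (white) vertices $w$ such that some force $v\to w$ is in $\mathcal F$ and $v$ can force $w$ by the rule when exactly the vertices in $\bigcup_{i=0}^t\mathcal F^{(i)}$ are blue. The propagation time $\operatorname{pt}_{\lfloor \operatorname{Z}\rfloor}(G;\mathcal F)$ is the least $t'$ with $V(G)=\bigcup_{i=0}^{t'}\mathcal F^{(i)}$, and is $\infty$ if the forces in $\mathcal F$ do not color all of $V(G)$ blue. Define $\operatorname{pt}_{\lfloor \operatorname{Z}\rfloor}(G;B)$ as the minimum of $\operatorname{pt}_{\lfloor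 \operatorname{Z}\rfloor}(G;\mathcal F)$ over all sets $\mathcal F$ of $\lfloor \operatorname{Z}\rfloor$ forces of $B$, $\operatorname{th}_{\lfloor \operatorname{Z}\rfloor}(G;B)=|B|+\operatorname{pt}_{\lfloor \operatorname{Z}\rfloor}(G;B)$, and $\operatorname{th}_{\lfloor \operatorname{Z}\rfloor}(G)=\min_{B\subseteq V(G)}\operatorname{th}_{\lfloor \operatorname{Z}\rfloor}(G;B)$. *)

theory Defs
  imports
    "Graph_Theory.Kuratowski"
    "Graph_Theory.Digraph_Isomorphism"
    "HOL-Library.Extended_Nat"
begin

text \<open>Finite simple undirected graphs are the symmetric digraphs of locale \<^locale>\<open>graph\<close>
  (finite, no loops, no parallel arcs); the null graph is allowed.\<close>

definition complete_graph :: "nat \<Rightarrow> (nat, nat \<times> nat) pre_digraph" where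
  "complete_graph n =
     with_proj \<lparr>pverts = {..<n}, parcs = {(i, j). i < n \<and> j < n \<and> i \<noteq> j}\<rparr>"

definition edgeless_graph :: "nat \<Rightarrow> (nat, nat \<times> nat) pre_digraph" where
  "edgeless_graph n = with_proj \<lparr>pverts = {..<n}, parcs = {}\<rparr>"

lemma complete_graph_complete_digraph: "complete_digraph n (complete_graph n)"
  unfolding complete_graph_def complete_digraph_pair_def by auto

lemma graph_edgeless_graph: "graph (edgeless_graph n)"
proof -
  interpret pair_graph "\<lparr>pverts = {..<n}, parcs = {}\<rparr>"
    by unfold_locales (auto simp: symmetric_def intro: symI)
  show ?thesis unfolding edgeless_graph_def by unfold_locales
qed

text \<open>\<open>can_force G S P u w\<close>: the vertex \<open>u\<close> can force the white vertex \<open>w\<close> when \<open>S\<close> is the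
  set of blue vertices and \<open>P\<close> the set of vertices that have already performed a force.
  The second disjunct is the hop; \<open>u \<notin> P\<close> says that \<open>u\<close> is active.\<close>

definition can_force :: "('a, 'b) pre_digraph \<Rightarrow> 'a set \<Rightarrow> 'a set \<Rightarrow> 'a \<Rightarrow> 'a \<Rightarrow> bool" where
  "can_force G S P u w \<longleftrightarrow> u \<in> S \<and> w \<in> verts G - S \<and>
     ({x. u \<rightarrow>\<^bsub>G\<^esub> x \<and> x \<notin> S} = {w} \<or> u \<notin> P \<and> (\<forall>x. u \<rightarrow>\<^bsub>G\<^esub> x \<longrightarrow> x \<in> S))"

text \<open>A force \<open>u \<rightarrow> w\<close> is the pair \<open>(u, w)\<close>. After the forces in \<open>F\<close>, starting from the blue set
  \<open>B\<close>, the blue vertices are \<open>B \<union> snd ` F\<close> and \<open>fst ` F\<close> have performed a force.\<close>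

inductive partial_forces :: "('a, 'b) pre_digraph \<Rightarrow> 'a set \<Rightarrow> ('a \<times> 'a) set \<Rightarrow> bool"
  for G B where
  start: "partial_forces G B {}"
| force: "partial_forces G B F \<Longrightarrow> can_force G (B \<union> snd ` F) (fst ` F) u w \<Longrightarrow>
          partial_forces G B (insert (u, w) F)"

definition set_of_forces :: "('a, 'b) pre_digraph \<Rightarrow> 'a set \<Rightarrow> ('a \<times> 'a) set \<Rightarrow> bool" where
  "set_of_forces G B F \<longleftrightarrow> partial_forces G B F \<and>
     (\<nexists>u w. can_force G (B \<union> snd ` F) (fst ` F) u w)"

text \<open>\<open>layer G B F t\<close> is the set \<open>\<F>\<^sup>(\<^sup>t\<^sup>)\<close>. When exactly the vertices in \<open>S\<close> are blue, the forces
  of \<open>F\<close> performed so far are those whose target lies in \<open>S\<close>.\<close>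

fun layer :: "('a, 'b) pre_digraph \<Rightarrow> 'a set \<Rightarrow> ('a \<times> 'a) set \<Rightarrow> nat \<Rightarrow> 'a set" where
  "layer G B F 0 = B"
| "layer G B F (Suc t) =
     (let S = (\<Union>i\<le>t. layer G B F i)
      in {w. \<exists>v. (v, w) \<in> F \<and> can_force G S {u. \<exists>x\<in>S. (u, x) \<in> F} v w})"

text \<open>\<^term>\<open>Inf {} = (\<infinity>::enat)\<close>, which covers the case where \<open>F\<close> does not
  colour all vertices (lemma \<open>pt_forces_eq_infinity_iff\<close> below).\<close>

definition pt_forces :: "('a, 'b) pre_digraph \<Rightarrow> 'a set \<Rightarrow> ('a \<times> 'a) set \<Rightarrow> enat" where
  "pt_forces G B F = Inf {enat t | t. verts G = (\<Union>i\<le>t. layer G B F i)}"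

definition pt :: "('a, 'b) pre_digraph \<Rightarrow> 'a set \<Rightarrow> enat" where
  "pt G B = Inf {pt_forces G B F | F. set_of_forces G B F}"

definition th_set :: "('a, 'b) pre_digraph \<Rightarrow> 'a set \<Rightarrow> enat" where
  "th_set G B = enat (card B) + pt G B"

definition th :: "('a, 'b) pre_digraph \<Rightarrow> enat" where
  "th G = Inf {th_set G B | B. B \<subseteq> verts G}"

lemma partial_forces_inv:
  assumes "partial_forces G B F"
  shows "finite F \<and> snd ` F \<subseteq> verts G - B \<and> inj_on fst F \<and>
    (\<forall>v\<in>fst ` F. \<forall>x. v \<rightarrow>\<^bsub>G\<^esub> x \<longrightarrow> x \<in> B \<union> snd ` F)"
  using assms
proof induction
  case start
  then show ?case by simp
next
  case (force F u w)
  have "u \<notin> fst ` F" using force unfolding can_force_def by blast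
  moreover have "w \<in> verts G - B" using force(2) unfolding can_force_def by blast
  moreover have "\<forall>x. u \<rightarrow>\<^bsub>G\<^esub> x \<longrightarrow> x \<in> B \<union> insert w (snd ` F)"
    using force(2) unfolding can_force_def by blast
  ultimately show ?case using force.IH by auto
qed

lemma partial_forces_layer:
  assumes F: "partial_forces G B F" and F': "partial_forces G B F'" and "F' \<subseteq> F"
  shows "\<exists>t. B \<union> snd ` F' \<subseteq> (\<Union>i\<le>t. layer G B F i)"
  using F' \<open>F' \<subseteq> F\<close>
proof induction
  case start
  then show ?case by (intro exI[of _ 0]) auto
next
  case (force F' u w)
  then obtain t where t: "B \<union> snd ` F' \<subseteq> (\<Union>i\<le>t. layer G B F i)" by auto
  define S where "S = (\<Union>i\<le>t. layer G B F i)"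
  have inj: "inj_on fst F" using partial_forces_inv[OF F] by simp
  have uw: "(u, w) \<in> F" using force.prems by simp
  have "w \<in> (\<Union>i\<le>Suc t. layer G B F i)"
  proof (cases "w \<in> S")
    case True
    then show ?thesis unfolding S_def by fastforce
  next
    case False
    have "\<And>x. (u, x) \<in> F \<Longrightarrow> x = w" using inj_onD[OF inj _ _ uw] by fastforce
    then have act: "u \<notin> {u. \<exists>x\<in>S. (u, x) \<in> F}" using False by auto
    have cf: "can_force G (B \<union> snd ` F') (fst ` F') u w" by (fact force.hyps)
    have sub: "B \<union> snd ` F' \<subseteq> S" using t S_def by simp
    have w: "w \<in> verts G - S" and u: "u \<in> S"
      using cf sub False unfolding can_force_def by auto
    consider "{x. u \<rightarrow>\<^bsub>G\<^esub> x \<and> x \<notin> B \<union> snd ` F'} = {w}"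
      | "\<forall>x. u \<rightarrow>\<^bsub>G\<^esub> x \<longrightarrow> x \<in> B \<union> snd ` F'"
      using cf unfolding can_force_def by blast
    then have "can_force G S {u. \<exists>x\<in>S. (u, x) \<in> F} u w"
    proof cases
      case 1
      then have "{x. u \<rightarrow>\<^bsub>G\<^esub> x \<and> x \<notin> S} = {w}" using sub False by blast
      then show ?thesis using w u unfolding can_force_def by blast
    next
      case 2
      then have "\<forall>x. u \<rightarrow>\<^bsub>G\<^esub> x \<longrightarrow> x \<in> S" using sub by blast
      then show ?thesis using w u act unfolding can_force_def by blast
    qed
    then have "w \<in> layer G B F (Suc t)"
      using uw unfolding layer.simps Let_def S_def[symmetric] by blast
    then show ?thesis by blast
  qed
  moreover have "S \<subseteq> (\<Union>i\<le>Suc t. layer G B F i)" unfolding S_def by force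
  moreover have "B \<union> snd ` F' \<subseteq> S" using t by (simp only: S_def)
  ultimately have "insert w (B \<union> snd ` F') \<subseteq> (\<Union>i\<le>Suc t. layer G B F i)"
    by (meson insert_subsetI order_trans)
  then show ?case by (intro exI[of _ "Suc t"]) (simp only: image_insert snd_conv Un_insert_right)
qed

lemma layer_subset: "layer G B F t \<subseteq> B \<union> snd ` F"
proof (cases t)
  case (Suc n)
  then show ?thesis by (force simp: Let_def)
qed simp

lemma pt_forces_eq_infinity_iff:
  assumes "B \<subseteq> verts G" "set_of_forces G B F"
  shows "pt_forces G B F = \<infinity> \<longleftrightarrow> B \<union> snd ` F \<noteq> verts G"
proof -
  have F: "partial_forces G B F" using assms(2) by (simp add: set_of_forces_def)
  have sub: "B \<union> snd ` F \<subseteq> verts G" using partial_forces_inv[OF F] assms(1) by auto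
  have "(\<exists>t. verts G = (\<Union>i\<le>t. layer G B F i)) \<longleftrightarrow> B \<union> snd ` F = verts G" (is "?L \<longleftrightarrow> ?R")
  proof
    assume ?L then show ?R using layer_subset[of G B F] sub by blast
  next
    assume R: ?R
    obtain t where "B \<union> snd ` F \<subseteq> (\<Union>i\<le>t. layer G B F i)"
      using partial_forces_layer[OF F F] by auto
    moreover have "(\<Union>i\<le>t. layer G B F i) \<subseteq> B \<union> snd ` F" using layer_subset[of G B F] by blast
    ultimately have "B \<union> snd ` F = (\<Union>i\<le>t. layer G B F i)" by (rule subset_antisym)
    then show ?L unfolding R by (rule exI)
  qed
  moreover have "pt_forces G B F = \<infinity> \<longleftrightarrow> \<not> (\<exists>t. verts G = (\<Union>i\<le>t. layer G B F i))"
  proof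
    assume inf: "pt_forces G B F = \<infinity>"
    show "\<not> (\<exists>t. verts G = (\<Union>i\<le>t. layer G B F i))"
    proof
      assume "\<exists>t. verts G = (\<Union>i\<le>t. layer G B F i)"
      then obtain t where "verts G = (\<Union>i\<le>t. layer G B F i)" ..
      then have "pt_forces G B F \<le> enat t" unfolding pt_forces_def by (intro Inf_lower) blast
      then show False using inf by simp
    qed
  next
    assume "\<not> (\<exists>t. verts G = (\<Union>i\<le>t. layer G B F i))"
    then have "{enat t | t. verts G = (\<Union>i\<le>t. layer G B F i)} = {}" by blast
    then show "pt_forces G B F = \<infinity>" by (simp add: pt_forces_def Inf_enat_def)
  qed
  ultimately show ?thesis by blast
qed

end

(* In each time step every blue vertex forces at most once, so the number of blue vertices at most
   doubles and |V| <= |B| * 2^t when B colours the graph in t steps. If |B| + t <= 2 then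
   |B| * 2^t <= |B| + t, while taking B = V shows that the throttling number is at most |V|. Hence
   the throttling number is 2 exactly for the graphs on two vertices. *)

theory Submission
  imports Defs
begin

text \<open>Since \<open>fst\<close> is injective on \<open>F\<close>, each vertex is the source of
  at most one force. The vertices coloured in one step are targets of forces whose sources are
  already blue, so there are at most as many of them as blue vertices.\<close>

lemma card_blue_Suc_le:
  assumes "finite B" "partial_forces G B F"
  shows "card (\<Union>i\<le>Suc t. layer G B F i) \<le> 2 * card (\<Union>i\<le>t. layer G B F i)"
proof -
  define S where "S = (\<Union>i\<le>t. layer G B F i)"
  have fin: "finite F" and inj: "inj_on fst F"
    using partial_forces_inv[OF assms(2)] by simp_all
  have "S \<subseteq> B \<union> snd ` F"
    using layer_subset[of G B F] unfolding S_def by blast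
  then have "finite S"
    using fin assms(1) finite_subset by blast
  have "layer G B F (Suc t) \<subseteq> snd ` (F \<inter> S \<times> UNIV)"
    unfolding layer.simps Let_def S_def[symmetric] can_force_def by force
  then have "card (layer G B F (Suc t)) \<le> card (snd ` (F \<inter> S \<times> UNIV))"
    by (intro card_mono) (use fin in auto)
  also have "\<dots> \<le> card (F \<inter> S \<times> UNIV)"
    by (intro card_image_le) (use fin in auto)
  also have "\<dots> = card (fst ` (F \<inter> S \<times> UNIV))"
    by (rule card_image[symmetric]) (use inj in \<open>auto intro: inj_on_subset\<close>)
  also have "\<dots> \<le> card S"
    by (intro card_mono \<open>finite S\<close>) auto
  finally have "card (layer G B F (Suc t)) \<le> card S" .
  then have "card (S \<union> layer G B F (Suc t)) \<le> 2 * card S"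
    using card_Un_le[of S "layer G B F (Suc t)"] by linarith
  moreover have "(\<Union>i\<le>Suc t. layer G B F i) = S \<union> layer G B F (Suc t)"
    unfolding S_def atMost_Suc by blast
  ultimately show ?thesis
    unfolding S_def by (simp only:)
qed

lemma card_blue_le:
  assumes "finite B" "partial_forces G B F"
  shows "card (\<Union>i\<le>t. layer G B F i) \<le> card B * 2 ^ t"
proof (induction t)
  case (Suc t)
  then show ?case using card_blue_Suc_le[OF assms, of t] by simp
qed simp

text \<open>The infimum of a nonempty set of \<open>enat\<close> is its least element, and a finite
  value rules out the empty set, whose infimum is \<infinity>.\<close>

lemma Inf_enat_in:
  fixes A :: "enat set"
  assumes "Inf A = enat n"
  shows "enat n \<in> A"
proof -
  have "A \<noteq> {}" using assms by (auto simp: Inf_enat_def)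
  then have "Inf A \<in> A" by (auto simp: Inf_enat_def intro: LeastI)
  then show ?thesis using assms by simp
qed

text \<open>A finite value forces each of the three nested infima (over \<open>B\<close>,
  \<open>F\<close> and \<open>t\<close>) to be finite, hence attained.\<close>

lemma th_eq_enatE:
  assumes "th G = enat k"
  obtains B F t where "B \<subseteq> verts G" "set_of_forces G B F"
    "verts G = (\<Union>i\<le>t. layer G B F i)" "card B + t = k"
proof -
  obtain B where B: "B \<subseteq> verts G" "th_set G B = enat k"
    using Inf_enat_in[OF assms[unfolded th_def]] by auto
  then obtain t where t: "pt G B = enat t" "card B + t = k"
    by (cases "pt G B") (auto simp: th_set_def)
  then obtain F where F: "set_of_forces G B F" "pt_forces G B F = enat t"
    using Inf_enat_in[OF t(1)[unfolded pt_def]] by auto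
  then have "verts G = (\<Union>i\<le>t. layer G B F i)"
    using Inf_enat_in[OF F(2)[unfolded pt_forces_def]] by auto
  then show thesis using that B F t by blast
qed

text \<open>With all vertices blue at the start, the empty set of forces is complete and the
  propagation time is 0.\<close>

lemma th_le_card: "th G \<le> enat (card (verts G))"
proof -
  have "set_of_forces G (verts G) {}"
    by (auto simp: set_of_forces_def can_force_def intro: partial_forces.start)
  then have "pt G (verts G) \<le> pt_forces G (verts G) {}"
    unfolding pt_def by (intro Inf_lower) blast
  also have "\<dots> \<le> enat 0"
    unfolding pt_forces_def by (intro Inf_lower) (auto intro!: exI[of _ 0])
  finally have "pt G (verts G) = enat 0" by (simp add: enat_0)
  then have "th_set G (verts G) = enat (card (verts G))"
    by (simp add: th_set_def)
  moreover have "th G \<le> th_set G (verts G)"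
    unfolding th_def by (intro Inf_lower) blast
  ultimately show ?thesis by simp
qed

lemma card_le_th:
  assumes "finite (verts G)" "th G \<le> 2"
  shows "enat (card (verts G)) \<le> th G"
proof -
  obtain k where k: "th G = enat k" "k \<le> 2"
    using assms(2) by (cases "th G") (auto simp: numeral_eq_enat)
  from k(1) obtain B F t where B: "B \<subseteq> verts G" "set_of_forces G B F"
    "verts G = (\<Union>i\<le>t. layer G B F i)" "card B + t = k"
    by (rule th_eq_enatE)
  have "card (verts G) \<le> card B * 2 ^ t"
    using card_blue_le[of B G F t] B(2) finite_subset[OF B(1) assms(1)]
    unfolding set_of_forces_def B(3)[symmetric] by blast
  also have "\<dots> \<le> card B + t"
  proof -
    \<comment> \<open>These cases exhaust \<open>card B + t \<le> 2\<close>. The bound 2 is sharp: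
      \<open>card B = 1\<close>, \<open>t = 2\<close> would give 4 > 3.\<close>
    from B(4) k(2) consider "card B = 0" | "t = 0" | "card B = 1" "t = 1" by linarith
    then show ?thesis by cases simp_all
  qed
  finally show ?thesis using B(4) k(1) by simp
qed

text \<open>From \<open>card (verts G) = 2\<close>, \<open>th_le_card\<close> first supplies the
  hypothesis \<open>th G \<le> 2\<close> of \<open>card_le_th\<close>.\<close>

lemma th_eq_2_iff:
  assumes "finite (verts G)"
  shows "th G = 2 \<longleftrightarrow> card (verts G) = 2"
  using th_le_card[of G] card_le_th[OF assms] by (auto simp: numeral_eq_enat)

lemma digraph_iso_card_verts:
  assumes "digraph_iso G H"
  shows "card (verts G) = card (verts H)"
  using assms unfolding digraph_iso_def
  by (auto simp: card_image pre_digraph.digraph_isomorphism_inj_on_verts)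

text \<open>Without parallel arcs an arc is determined by its ends, so arcs of any type can be
  renamed to pairs of relabelled ends. This reduces an isomorphism with a concrete graph on numbers
  to a vertex bijection.\<close>

lemma (in nomulti_digraph) digraph_iso_with_proj:
  assumes "inj_on f (verts G)"
  shows "digraph_iso G
    (with_proj \<lparr>pverts = f ` verts G, parcs = map_prod f f ` arcs_ends G\<rparr>)"
proof -
  define h where "h = \<lparr>iso_verts = f, iso_arcs = map_prod f f \<circ> arc_to_ends G,
    iso_head = snd, iso_tail = fst\<rparr>"
  have "arcs_ends G \<subseteq> verts G \<times> verts G"
    by (auto simp: arcs_ends_conv)
  \<comment> \<open>All ends lie in \<open>verts G\<close>, where \<open>f\<close> is
    injective.\<close>
  then have "inj_on (map_prod f f) (arc_to_ends G ` arcs G)"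
    unfolding arcs_ends_def
    by (rule inj_on_subset[OF map_prod_inj_on[OF assms assms]])
  then have "inj_on (map_prod f f \<circ> arc_to_ends G) (arcs G)"
    by (intro comp_inj_on inj_on_arc_to_ends)
  then have "digraph_isomorphism h"
    using assms wf_digraph by (simp add: digraph_isomorphism_def h_def arc_to_ends_def)
  moreover have "with_proj \<lparr>pverts = f ` verts G, parcs = map_prod f f ` arcs_ends G\<rparr> = app_iso h G"
    by (simp add: app_iso_def with_proj_def h_def arcs_ends_def image_comp)
  ultimately show ?thesis unfolding digraph_iso_def by blast
qed

text \<open>Any bijection of the vertices onto \<open>{..<n}\<close> works: being injective, it
  carries the pairs of distinct vertices exactly onto the pairs of distinct numbers.\<close>

lemma digraph_iso_complete_graph:
  assumes "complete_digraph n G"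
  shows "digraph_iso G (complete_graph n)"
proof -
  interpret graph G using assms by (simp add: complete_digraph_def)
  obtain f where f: "bij_betw f (verts G) {..<n}"
    using assms finite_verts ex_bij_betw_finite_nat[of "verts G"]
    by (auto simp: complete_digraph_def atLeast0LessThan)
  have V: "f ` verts G = {..<n}" and inj: "inj_on f (verts G)"
    using f by (simp_all add: bij_betw_def)
  have "map_prod f f ` arcs_ends G = {(i, j). i \<in> f ` verts G \<and> j \<in> f ` verts G \<and> i \<noteq> j}"
    using assms inj by (auto simp: complete_digraph_def dest: inj_onD)
  then show ?thesis
    using digraph_iso_with_proj[OF inj] V by (simp add: complete_graph_def)
qed

lemma (in nomulti_digraph) digraph_iso_edgeless_graph:
  assumes "finite (verts G)" "arcs_ends G = {}"
  shows "digraph_iso G (edgeless_graph (card (verts G)))"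
proof -
  obtain f where "bij_betw f (verts G) {..<card (verts G)}"
    using assms(1) ex_bij_betw_finite_nat[of "verts G"] by (auto simp: atLeast0LessThan)
  then show ?thesis
    using digraph_iso_with_proj[of f] assms(2) by (simp add: bij_betw_def edgeless_graph_def)
qed

theorem proposition5p2:
  fixes G :: "('a, 'b) pre_digraph"
  assumes "graph G"
  shows "th G = 2 \<longleftrightarrow> digraph_iso G (complete_graph 2) \<or> digraph_iso G (edgeless_graph 2)"
proof -
  interpret graph G by fact
  \<comment> \<open>By \<open>th_eq_2_iff\<close> it remains to classify the graphs on two
    vertices.\<close>
  have "digraph_iso G (complete_graph 2) \<or> digraph_iso G (edgeless_graph 2)"
    if card: "card (verts G) = 2"
  proof (cases "arcs_ends G = {}")
    case True
    then show ?thesis using digraph_iso_edgeless_graph card by simp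
  next
    case False
    then obtain u v where uv: "(u, v) \<in> arcs_ends G" by auto
    then have "u \<in> verts G" "v \<in> verts G" "u \<noteq> v"
      by (auto simp: arcs_ends_conv dest: no_loops)
    then have V: "verts G = {u, v}"
      using card by (auto simp: card_2_iff)
    \<comment> \<open>Symmetry gives the reverse arc and loops are excluded, so a single arc already
      makes the graph complete.\<close>
    have "(v, u) \<in> arcs_ends G"
      using arcs_ends_symmetric[OF sym_arcs] uv by blast
    moreover have "arcs_ends G \<subseteq> verts G \<times> verts G - Id"
      by (auto simp: arcs_ends_conv dest: no_loops)
    ultimately have "arcs_ends G = {(x, y). (x, y) \<in> verts G \<times> verts G \<and> x \<noteq> y}"
      using uv V by auto
    then show ?thesis
      using digraph_iso_complete_graph[of 2 G] assms card by (simp add: complete_digraph_def)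
  qed
  moreover have "card (verts G) = 2"
    if "digraph_iso G (complete_graph 2) \<or> digraph_iso G (edgeless_graph 2)"
    using that digraph_iso_card_verts[of G "complete_graph 2"]
      digraph_iso_card_verts[of G "edgeless_graph 2"]
    by (auto simp: complete_graph_def edgeless_graph_def)
  ultimately show ?thesis using th_eq_2_iff[OF finite_verts] by blast
qed

end
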